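(* Let $\Lambda=\Delta-\Psi$ be the zeon combinatorial Laplacian of a simple graph on $m$ vertices, and let $\Lambda_{\rm sym}=\Delta-(\Psi+\Psi^\dagger)$. If $\lambda$ is the zeon eigenvalue of $\Lambda$ associated with a vertex of unique degree $d=\mathfrak{C}\lambda$, then $\lambda_*=\mathfrak{C}\lambda+2\,\mathfrak{D}\lambda$ is the unique zeon eigenvalue of $\Lambda_{\rm sym}$ satisfying $\mathfrak{C}\lambda_*=\mathfrak{C}\lambda$.
   Context: Zeon algebra: $\mathbb{C}\mathfrak{Z}$ is the commutative unital complex algebra generated by $\zeta_{\{i\}}$, $i\in\mathbb{N}=\{1,2,\ldots\}$, and the scalar $1=\zeta_\varnothing$, with $\zeta_{\{i\}}\zeta_{\{j\}}=\zeta_{\{j\}}\zeta_{\{i\}}=\zeta_{\{i,j\}}$ for $i\neq j$ and $\zeta_{\{i\}}^2=0$. For finite $I\subset\mathbb{N}$, $\zeta_I=\prod_{i\in I}\zeta_{\{i\}}$; the $\zeta_I$ form a vector space basis. For $u=\sum_I u_I\zeta_I$, the scalar part is $\mathfrak{C}u=u_\varnothing$, the dual (nilpotent) part is $\mathfrak{D}u=u-\mathfrak{C}u$, and $\overline{u}=\sum_I\overline{u_I}\zeta_I$. For a matrix $A$ over $\mathbb{C}\mathfrak{Z}$, $A^\dagger=\overline{A}^{\intercal}$ is the conjugate transpose. Eigenvalues: for $A\in\mathrm{Mat}(m,\mathbb{C}\mathfrak{Z})$, $\lambda\in\mathbb{C}\mathfrak{Z}$ is a (zeon) eigenvalue if $A\xi=\lambda\xi$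 for some non-null $\xi\in\mathbb{C}\mathfrak{Z}^m$ (non-null: $\mathfrak{C}(\xi^\dagger\xi)\neq0$; equivalently some component of $\xi$ has nonzero scalar part). Graphs: for a simple finite graph with vertices $v_1,\ldots,v_m$ and edge set $E$, the nilpotent adjacency matrix $\Psi=(\psi_{ij})$ has $\psi_{ij}=\zeta_{\{j\}}$ if $\{v_i,v_j\}\in E$ and $\psi_{ij}=0$ otherwise; $\Delta=\mathrm{diag}(\deg v_1,\ldots,\deg v_m)$; $\Lambda=\Delta-\Psi$. A vertex is of unique degree $d$ if it is the only vertex of degree $d$; the eigenvalue of $\Lambda$ associated with that vertex is the unique eigenvalue $\lambda$ of $\Lambda$ with $\mathfrak{C}\lambda=d$. *)

theory Defs
  imports "Jordan_Normal_Form.Matrix"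
begin

section \<open>The complex zeon algebra\<close>

text \<open>An element is given by its family of coefficients on the basis of all \<open>\<zeta>\<^sub>I\<close>, with \<open>I\<close>
  a finite set of positive integers; all but finitely many coefficients vanish.\<close>

typedef zeon =
  "{u :: nat set \<Rightarrow> complex. finite {I. u I \<noteq> 0} \<and> (\<forall>I. u I \<noteq> 0 \<longrightarrow> finite I \<and> 0 \<notin> I)}"
  morphisms zcoeff Abs_zeon
  by (rule exI[of _ "\<lambda>_. 0"]) simp

setup_lifting type_definition_zeon

lemma zeon_eqI: "(\<And>I. zcoeff u I = zcoeff v I) \<Longrightarrow> u = v"
  by (simp add: zcoeff_inject[symmetric] fun_eq_iff)

lemma finite_support_zcoeff: "finite {I. zcoeff u I \<noteq> 0}"
  using zcoeff[of u] by simp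

lemma zcoeff_eq_0: "infinite I \<or> 0 \<in> I \<Longrightarrow> zcoeff u I = 0"
  using zcoeff[of u] by blast

instantiation zeon :: comm_ring_1
begin

lift_definition zero_zeon :: zeon is "\<lambda>_. 0" by simp

lift_definition one_zeon :: zeon is "\<lambda>I. if I = {} then 1 else 0" by simp

lift_definition plus_zeon :: "zeon \<Rightarrow> zeon \<Rightarrow> zeon" is "\<lambda>u v I. u I + v I"
proof -
  fix u v :: "nat set \<Rightarrow> complex"
  assume u: "finite {I. u I \<noteq> 0} \<and> (\<forall>I. u I \<noteq> 0 \<longrightarrow> finite I \<and> 0 \<notin> I)"
    and v: "finite {I. v I \<noteq> 0} \<and> (\<forall>I. v I \<noteq> 0 \<longrightarrow> finite I \<and> 0 \<notin> I)"
  have "finite {I. u I + v I \<noteq> 0}"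
    by (rule finite_subset[of _ "{I. u I \<noteq> 0} \<union> {I. v I \<noteq> 0}"]) (use u v in auto)
  moreover have "\<forall>I. u I + v I \<noteq> 0 \<longrightarrow> finite I \<and> 0 \<notin> I"
    using u v by (metis add_0)
  ultimately show "finite {I. u I + v I \<noteq> 0} \<and> (\<forall>I. u I + v I \<noteq> 0 \<longrightarrow> finite I \<and> 0 \<notin> I)" ..
qed

lift_definition uminus_zeon :: "zeon \<Rightarrow> zeon" is "\<lambda>u I. - u I" by simp

definition minus_zeon :: "zeon \<Rightarrow> zeon \<Rightarrow> zeon" where "minus_zeon u v = u + - v"

text \<open>The product extends \<open>\<zeta>\<^sub>J \<zeta>\<^sub>K = \<zeta>\<^sub>J\<^sub>\<union>\<^sub>K\<close> for \<open>J \<inter> K = {}\<close> and \<open>\<zeta>\<^sub>J \<zeta>\<^sub>K = 0\<close> otherwise.\<close>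

lift_definition times_zeon :: "zeon \<Rightarrow> zeon \<Rightarrow> zeon" is "\<lambda>u v I. \<Sum>J\<in>Pow I. u J * v (I - J)"
proof -
  fix u v :: "nat set \<Rightarrow> complex"
  assume u: "finite {I. u I \<noteq> 0} \<and> (\<forall>I. u I \<noteq> 0 \<longrightarrow> finite I \<and> 0 \<notin> I)"
    and v: "finite {I. v I \<noteq> 0} \<and> (\<forall>I. v I \<noteq> 0 \<longrightarrow> finite I \<and> 0 \<notin> I)"
  have ex: "\<exists>J\<subseteq>I. u J \<noteq> 0 \<and> v (I - J) \<noteq> 0" if "(\<Sum>J\<in>Pow I. u J * v (I - J)) \<noteq> 0" for I
    using that by (auto elim!: sum.not_neutral_contains_not_neutral)
  have "finite {I. (\<Sum>J\<in>Pow I. u J * v (I - J)) \<noteq> 0}"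
  proof (rule finite_subset)
    show "finite ((\<lambda>(J, K). J \<union> K) ` ({I. u I \<noteq> 0} \<times> {I. v I \<noteq> 0}))"
      using u v by simp
    show "{I. (\<Sum>J\<in>Pow I. u J * v (I - J)) \<noteq> 0}
        \<subseteq> (\<lambda>(J, K). J \<union> K) ` ({I. u I \<noteq> 0} \<times> {I. v I \<noteq> 0})"
    proof
      fix I assume "I \<in> {I. (\<Sum>J\<in>Pow I. u J * v (I - J)) \<noteq> 0}"
      then obtain J where "J \<subseteq> I" "u J \<noteq> 0" "v (I - J) \<noteq> 0" using ex by blast
      then show "I \<in> (\<lambda>(J, K). J \<union> K) ` ({I. u I \<noteq> 0} \<times> {I. v I \<noteq> 0})"
        by (intro image_eqI[of _ _ "(J, I - J)"]) auto
    qed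
  qed
  moreover have "finite I \<and> 0 \<notin> I" if nz: "(\<Sum>J\<in>Pow I. u J * v (I - J)) \<noteq> 0" for I
  proof -
    obtain J where J: "J \<subseteq> I" "u J \<noteq> 0" "v (I - J) \<noteq> 0" using ex[OF nz] by blast
    then have "finite J" "finite (I - J)" "0 \<notin> J" "0 \<notin> I - J" using u v by blast+
    then show ?thesis by auto
  qed
  ultimately show "finite {I. (\<Sum>J\<in>Pow I. u J * v (I - J)) \<noteq> 0} \<and>
      (\<forall>I. (\<Sum>J\<in>Pow I. u J * v (I - J)) \<noteq> 0 \<longrightarrow> finite I \<and> 0 \<notin> I)" by blast
qed

instance
proof
  fix a b c :: zeon
  show "a + b + c = a + (b + c)" "a + b = b + a" "0 + a = a" "- a + a = 0"
    by (transfer; simp add: fun_eq_iff)+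
  show "a - b = a + - b"
    by (simp add: minus_zeon_def)
  show "(0::zeon) \<noteq> 1"
    by transfer (auto simp: fun_eq_iff)
  show "(a + b) * c = a * c + b * c"
    by transfer (simp add: fun_eq_iff ring_distribs sum.distrib)
  show "a * b = b * a"
  proof (transfer, rule ext)
    fix a b :: "nat set \<Rightarrow> complex" and I
    show "(\<Sum>J\<in>Pow I. a J * b (I - J)) = (\<Sum>J\<in>Pow I. b J * a (I - J))"
      by (rule sum.reindex_bij_witness[of _ "\<lambda>J. I - J" "\<lambda>J. I - J"])
        (auto simp: double_diff mult.commute)
  qed
  show "1 * a = a"
  proof (rule zeon_eqI)
    fix I
    show "zcoeff (1 * a) I = zcoeff a I"
    proof (cases "finite I")
      case True
      then have "(\<Sum>J\<in>Pow I. (if J = {} then 1 else 0) * zcoeff a (I - J))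
          = (\<Sum>J\<in>{{}}. zcoeff a (I - J))"
        by (intro sum.mono_neutral_cong_right) auto
      then show ?thesis by (simp add: times_zeon.rep_eq one_zeon.rep_eq)
    qed (simp add: zcoeff_eq_0)
  qed
  show "a * b * c = a * (b * c)"
  proof (rule zeon_eqI)
    fix I
    show "zcoeff (a * b * c) I = zcoeff (a * (b * c)) I"
    proof (cases "finite I")
      case True
      have "(\<Sum>J\<in>Pow I. (\<Sum>K\<in>Pow J. zcoeff a K * zcoeff b (J - K)) * zcoeff c (I - J))
          = (\<Sum>(J, K)\<in>Sigma (Pow I) Pow. zcoeff a K * zcoeff b (J - K) * zcoeff c (I - J))"
        using True by (subst sum.Sigma[symmetric]) (auto simp: sum_distrib_right intro: finite_subset)
      also have "\<dots> = (\<Sum>(K, L)\<in>Sigma (Pow I) (\<lambda>K. Pow (I - K)).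
          zcoeff a K * (zcoeff b L * zcoeff c (I - K - L)))"
        by (rule sum.reindex_bij_witness[of _ "\<lambda>(K, L). (K \<union> L, K)" "\<lambda>(J, K). (K, J - K)"])
          (auto simp: mult.assoc Diff_Int_distrib2 intro!: arg_cong[where f = "zcoeff _"] arg_cong2[where f = "(*)"])
      also have "\<dots> = (\<Sum>K\<in>Pow I. zcoeff a K *
          (\<Sum>L\<in>Pow (I - K). zcoeff b L * zcoeff c (I - K - L)))"
        using True by (subst sum.Sigma[symmetric]) (auto simp: sum_distrib_left intro: finite_subset)
      finally show ?thesis by (simp add: times_zeon.rep_eq)
    qed (simp add: zcoeff_eq_0)
  qed
qed

end

lift_definition zscalar :: "complex \<Rightarrow> zeon" is "\<lambda>c I. if I = {} then c else 0"
  by (auto intro: finite_subset[of _ "{{}}"])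

lift_definition zgen :: "nat \<Rightarrow> zeon" is "\<lambda>i I. if I = {i} \<and> 0 < i then 1 else 0"
  by (auto intro: finite_subset[of _ "{{i}}" for i])

text \<open>\<open>zgen i\<close> is the generator \<open>\<zeta>\<^bsub>{i}\<^esub>\<close> for \<open>i \<ge> 1\<close>; the junk value \<open>zgen 0\<close> is \<open>0\<close>.
  The next facts recover the presentation of the algebra.\<close>

lemma zcoeff_zscalar_mult: "zcoeff (zscalar c * u) I = c * zcoeff u I"
proof (cases "finite I")
  case True
  then have "(\<Sum>J\<in>Pow I. (if J = {} then c else 0) * zcoeff u (I - J))
      = (\<Sum>J\<in>{{}}. c * zcoeff u (I - J))"
    by (intro sum.mono_neutral_cong_right) auto
  then show ?thesis by (simp add: times_zeon.rep_eq zscalar.rep_eq)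
qed (simp add: zcoeff_eq_0)

lemma zcoeff_sum: "zcoeff (\<Sum>x\<in>X. f x) I = (\<Sum>x\<in>X. zcoeff (f x) I)"
  by (induction X rule: infinite_finite_induct) (simp_all add: zero_zeon.rep_eq plus_zeon.rep_eq)

lemma zscalar_0 [simp]: "zscalar 0 = 0" and zscalar_1 [simp]: "zscalar 1 = 1"
  by (transfer; simp add: fun_eq_iff)+

lemma zscalar_add: "zscalar (a + b) = zscalar a + zscalar b"
  by transfer (simp add: fun_eq_iff)

lemma zscalar_mult: "zscalar (a * b) = zscalar a * zscalar b"
  by (rule zeon_eqI) (simp add: zcoeff_zscalar_mult, simp add: zscalar.rep_eq)

lemma zcoeff_prod_zgen:
  assumes "finite I" "0 \<notin> I"
  shows "zcoeff (\<Prod>i\<in>I. zgen i) J = (if J = I then 1 else 0)"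
  using assms
proof (induction I arbitrary: J rule: finite_induct)
  case empty
  then show ?case by (simp add: one_zeon.rep_eq)
next
  case (insert i I)
  have *: "zcoeff (zgen i * (\<Prod>i\<in>I. zgen i)) J
      = (\<Sum>K\<in>Pow J. (if K = {i} then 1 else 0) * (if J - K = I then 1 else 0))"
    using insert by (simp add: times_zeon.rep_eq zgen.rep_eq)
  show ?case
  proof (cases "finite J")
    case True
    have "(\<Sum>K\<in>Pow J. (if K = {i} then 1 else 0) * (if J - K = I then 1 else 0 :: complex))
      = (\<Sum>K\<in>Pow J. if K = {i} then (if J - {i} = I then 1 else 0) else 0)"
      by (intro sum.cong) auto
    also have "\<dots> = (if i \<in> J \<and> J - {i} = I then 1 else 0)"
      using True by (simp add: sum.delta)
    also have "i \<in> J \<and> J - {i} = I \<longleftrightarrow> J = Set.insert i I"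
      using insert.hyps by auto
    finally show ?thesis using * insert.hyps by simp
  next
    case False
    then show ?thesis using insert.hyps by (auto simp: zcoeff_eq_0)
  qed
qed

lemma zgen_square: "zgen i * zgen i = 0"
proof (rule zeon_eqI)
  fix I
  have "(\<Sum>J\<in>Pow I. zcoeff (zgen i) J * zcoeff (zgen i) (I - J)) = 0"
    by (rule sum.neutral) (auto simp: zgen.rep_eq)
  then show "zcoeff (zgen i * zgen i) I = zcoeff 0 I"
    by (simp add: times_zeon.rep_eq zero_zeon.rep_eq)
qed

lemma zeon_expansion:
  "u = (\<Sum>I | zcoeff u I \<noteq> 0. zscalar (zcoeff u I) * (\<Prod>i\<in>I. zgen i))"
proof (rule zeon_eqI)
  fix J
  have "(\<Sum>I | zcoeff u I \<noteq> 0. zcoeff (zscalar (zcoeff u I) * (\<Prod>i\<in>I. zgen i)) J)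
      = (\<Sum>I | zcoeff u I \<noteq> 0. if J = I then zcoeff u J else 0)"
    using zcoeff[of u] by (intro sum.cong refl) (auto simp: zcoeff_zscalar_mult zcoeff_prod_zgen)
  also have "\<dots> = zcoeff u J"
    by (simp add: finite_support_zcoeff)
  finally show "zcoeff u J = zcoeff (\<Sum>I | zcoeff u I \<noteq> 0. zscalar (zcoeff u I) * (\<Prod>i\<in>I. zgen i)) J"
    by (simp add: zcoeff_sum)
qed

definition scalar_part :: "zeon \<Rightarrow> complex" where
  "scalar_part u = zcoeff u {}"

definition dual_part :: "zeon \<Rightarrow> zeon" where
  "dual_part u = u - zscalar (scalar_part u)"

instantiation zeon :: conjugatable_ring
begin

lift_definition conjugate_zeon :: "zeon \<Rightarrow> zeon" is "\<lambda>u I. cnj (u I)" by simp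

instance
proof
  fix a b :: zeon
  show "conjugate (conjugate a) = a" "conjugate (- a) = - conjugate a"
    "conjugate (0::zeon) = 0" "conjugate (a + b) = conjugate a + conjugate b"
    by (transfer; simp add: fun_eq_iff)+
  show "conjugate a = conjugate b \<longleftrightarrow> a = b"
    by transfer (simp add: fun_eq_iff)
  show "conjugate (a * b) = conjugate a * conjugate b"
    by transfer (simp add: fun_eq_iff)
qed

end


section \<open>Zeon matrices and their eigenvalues\<close>

definition dagger :: "zeon mat \<Rightarrow> zeon mat" where
  "dagger A = transpose_mat (map_mat conjugate A)"

text \<open>\<open>conjugate \<xi> \<bullet> \<xi>\<close> is the zeon \<open>\<xi>\<^sup>\<dagger>\<xi>\<close>.\<close>

definition non_null :: "zeon vec \<Rightarrow> bool" where
  "non_null \<xi> \<longleftrightarrow> scalar_part (conjugate \<xi> \<bullet> \<xi>) \<noteq> 0"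

definition zeon_eigenvalue :: "zeon mat \<Rightarrow> zeon \<Rightarrow> bool" where
  "zeon_eigenvalue A \<mu> \<longleftrightarrow>
     (\<exists>\<xi> \<in> carrier_vec (dim_row A). non_null \<xi> \<and> A *\<^sub>v \<xi> = \<mu> \<cdot>\<^sub>v \<xi>)"


section \<open>Graphs and zeon Laplacians\<close>

definition simple_graph :: "'v set \<Rightarrow> 'v set set \<Rightarrow> bool" where
  "simple_graph V E \<longleftrightarrow> finite V \<and> (\<forall>e\<in>E. e \<subseteq> V \<and> card e = 2)"

definition graph_degree :: "'v set set \<Rightarrow> 'v \<Rightarrow> nat" where
  "graph_degree E x = card {e \<in> E. x \<in> e}"

definition unique_degree :: "'v set \<Rightarrow> 'v set set \<Rightarrow> 'v \<Rightarrow> bool" where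
  "unique_degree V E x \<longleftrightarrow> x \<in> V \<and> (\<forall>y\<in>V. graph_degree E y = graph_degree E x \<longrightarrow> y = x)"

text \<open>The vertices are enumerated as \<open>v 1, \<dots>, v m\<close>. Matrix indices start at \<open>0\<close>, so the
  matrix entry at \<open>(i, j)\<close> belongs to the vertices \<open>v (Suc i)\<close> and \<open>v (Suc j)\<close>.\<close>

definition nilpotent_adjacency :: "nat \<Rightarrow> (nat \<Rightarrow> 'v) \<Rightarrow> 'v set set \<Rightarrow> zeon mat" where
  "nilpotent_adjacency m v E =
     mat m m (\<lambda>(i, j). if {v (Suc i), v (Suc j)} \<in> E then zgen (Suc j) else 0)"

definition degree_matrix :: "nat \<Rightarrow> (nat \<Rightarrow> 'v) \<Rightarrow> 'v set set \<Rightarrow> zeon mat" where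
  "degree_matrix m v E =
     mat m m (\<lambda>(i, j). if i = j then of_nat (graph_degree E (v (Suc i))) else 0)"

definition zeon_laplacian :: "nat \<Rightarrow> (nat \<Rightarrow> 'v) \<Rightarrow> 'v set set \<Rightarrow> zeon mat" where
  "zeon_laplacian m v E = degree_matrix m v E - nilpotent_adjacency m v E"

definition zeon_laplacian_sym :: "nat \<Rightarrow> (nat \<Rightarrow> 'v) \<Rightarrow> 'v set set \<Rightarrow> zeon mat" where
  "zeon_laplacian_sym m v E =
     degree_matrix m v E - (nilpotent_adjacency m v E + dagger (nilpotent_adjacency m v E))"

text \<open>Over a vertex \<open>x\<close> of unique degree exactly one eigenvalue has scalar part \<open>graph_degree E x\<close>,
  so the description below is proper there; for other vertices the value is unspecified.\<close>

definition associated_eigenvalue ::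
  "nat \<Rightarrow> (nat \<Rightarrow> 'v) \<Rightarrow> 'v set set \<Rightarrow> 'v \<Rightarrow> zeon" where
  "associated_eigenvalue m v E x =
     (THE \<mu>. zeon_eigenvalue (zeon_laplacian m v E) \<mu> \<and>
             scalar_part \<mu> = of_nat (graph_degree E x))"

end

theory Submission
  imports Defs
begin

text \<open>Let \<open>p\<close> be the vertex of unique degree \<open>d\<close>. A zeon matrix whose scalar part is diagonal has
  at most one eigenvalue over a diagonal entry of multiplicity one: comparing two eigenvectors
  yields a homogeneous linear system with invertible scalar part. It remains to exhibit
  eigenvectors. On the other vertices let \<open>\<rho>\<close> solve
  \<open>(deg j - d) \<rho>\<^sub>j = \<zeta>\<^sub>j (A\<^sub>j\<^sub>p + (\<Sum>k. A\<^sub>j\<^sub>k \<rho>\<^sub>k))\<close>, and put \<open>c = (\<Sum>k. A\<^sub>p\<^sub>k \<rho>\<^sub>k)\<close>. Then \<open>\<lambda> = d - \<zeta>\<^sub>p c\<close>, with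
  an eigenvector whose entries away from \<open>p\<close> are multiples of \<open>\<zeta>\<^sub>p\<close>. For the symmetrized
  Laplacian the eigenvector is \<open>\<rho> + \<zeta>\<^sub>p \<tau>\<close> away from \<open>p\<close>; as \<open>\<zeta>\<^sub>j \<rho>\<^sub>j = 0\<close>, the terms \<open>\<rho>\<close> and \<open>\<zeta>\<^sub>p \<tau>\<close>
  each contribute \<open>\<zeta>\<^sub>p c\<close>, which accounts for the factor \<open>2\<close>. In terms of walks: only cycles through
  \<open>p\<close> survive, and \<open>\<Prod>(\<zeta>\<^sub>i + \<zeta>\<^sub>j)\<close> over the edges of a cycle is twice the product of its \<open>\<zeta>\<^sub>i\<close>.\<close>

section \<open>Linear systems over the zeon algebra\<close>

text \<open>The empty set splits only into empty sets, so \<open>scalar_part\<close> is a ring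
  homomorphism to the complex numbers.\<close>

lemma scalar_part_simps [simp]:
  "scalar_part 0 = 0" "scalar_part 1 = 1"
  "scalar_part (a + b) = scalar_part a + scalar_part b"
  "scalar_part (- a) = - scalar_part a"
  "scalar_part (a * b) = scalar_part a * scalar_part b"
  "scalar_part (zscalar c) = c"
  "scalar_part (zgen i) = 0"
  "scalar_part (conjugate a) = cnj (scalar_part a)"
  by (simp_all add: scalar_part_def zero_zeon.rep_eq one_zeon.rep_eq
      plus_zeon.rep_eq uminus_zeon.rep_eq times_zeon.rep_eq zscalar.rep_eq zgen.rep_eq
      conjugate_zeon.rep_eq)

lemma scalar_part_diff [simp]: "scalar_part (a - b) = scalar_part a - scalar_part b"
  using scalar_part_simps(3)[of a "- b"] by simp

lemma scalar_part_sum [simp]: "scalar_part (sum f X) = (\<Sum>x\<in>X. scalar_part (f x))"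
  by (simp add: scalar_part_def zcoeff_sum)

lemma zscalar_of_nat: "zscalar (of_nat n) = of_nat n"
  by (induction n) (simp_all add: zscalar_add)

lemma zscalar_uminus: "zscalar (- a) = - zscalar a"
  by (rule zeon_eqI) (simp add: zscalar.rep_eq uminus_zeon.rep_eq)

lemma zscalar_diff: "zscalar (a - b) = zscalar a - zscalar b"
  using zscalar_add[of a "- b"] by (simp add: zscalar_uminus)

lemma zscalar_inverse: "c \<noteq> 0 \<Longrightarrow> zscalar (inverse c) * zscalar c = 1"
  by (simp add: zscalar_mult[symmetric])

section \<open>Nilpotency through the filtration by degree\<close>

text \<open>The span of the \<open>\<zeta>\<^sub>I\<close> of degree at least \<open>n\<close> in
  the generators indexed by \<open>U\<close>. For finite \<open>U\<close> this filtration reaches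
  0.\<close>

definition order_ge :: "nat set \<Rightarrow> nat \<Rightarrow> zeon \<Rightarrow> bool" where
  "order_ge U n u \<longleftrightarrow> (\<forall>I. zcoeff u I \<noteq> 0 \<longrightarrow> I \<subseteq> U \<and> n \<le> card I)"

lemma order_ge_sum:
  assumes "\<And>x. x \<in> X \<Longrightarrow> order_ge U n (f x)"
  shows "order_ge U n (sum f X)"
  unfolding order_ge_def
proof (intro allI impI)
  fix I
  assume "zcoeff (sum f X) I \<noteq> 0"
  then obtain x where "x \<in> X" "zcoeff (f x) I \<noteq> 0"
    unfolding zcoeff_sum by (rule sum.not_neutral_contains_not_neutral)
  then show "I \<subseteq> U \<and> n \<le> card I"
    using assms unfolding order_ge_def by blast
qed

lemma order_ge_mult:
  assumes "order_ge U k a" "order_ge U n u"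
  shows "order_ge U (k + n) (a * u)"
  unfolding order_ge_def
proof (intro allI impI)
  fix I
  assume nz: "zcoeff (a * u) I \<noteq> 0"
  then have "finite I"
    using zcoeff_eq_0 by blast
  from nz have "(\<Sum>J\<in>Pow I. zcoeff a J * zcoeff u (I - J)) \<noteq> 0"
    by (simp add: times_zeon.rep_eq)
  then obtain J where "J \<in> Pow I" "zcoeff a J * zcoeff u (I - J) \<noteq> 0"
    by (rule sum.not_neutral_contains_not_neutral)
  then have J: "J \<subseteq> I" "zcoeff a J \<noteq> 0" "zcoeff u (I - J) \<noteq> 0"
    by auto
  have "card I = card J + card (I - J)"
    using J(1) \<open>finite I\<close> by (metis add_diff_inverse_nat card_Diff_subset card_mono finite_subset not_less)
  then show "I \<subseteq> U \<and> k + n \<le> card I"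
    using J assms unfolding order_ge_def by (metis Diff_partition Un_least add_mono)
qed

lemma order_ge_eq_0:
  assumes "finite U" "order_ge U n u" "card U < n"
  shows "u = 0"
proof (rule zeon_eqI)
  fix I
  show "zcoeff u I = zcoeff 0 I"
    using assms card_mono[of U I] unfolding order_ge_def
    by (fastforce simp: zero_zeon.rep_eq)
qed

text \<open>Each zeon involves finitely many generators, so finitely many zeons lie in one
  finite-dimensional subalgebra, where degrees are bounded.\<close>

lemma finite_common_support:
  assumes "finite X"
  obtains U where "finite U" "\<And>u. u \<in> X \<Longrightarrow> order_ge U 0 u"
    and "\<And>u. u \<in> X \<Longrightarrow> scalar_part u = 0 \<Longrightarrow> order_ge U 1 u"
proof
  let ?U = "\<Union>u\<in>X. \<Union>{I. zcoeff u I \<noteq> 0}"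
  show "finite ?U"
    using assms finite_support_zcoeff zcoeff_eq_0 by (fastforce intro!: finite_Union)
  show "order_ge ?U 0 u" if "u \<in> X" for u
    using that unfolding order_ge_def by auto
  show "order_ge ?U 1 u" if "u \<in> X" "scalar_part u = 0" for u
    unfolding order_ge_def
  proof (intro allI impI)
    fix I
    assume I: "zcoeff u I \<noteq> 0"
    then have "finite I" "I \<noteq> {}"
      using zcoeff_eq_0 that(2) by (auto simp: scalar_part_def)
    then have "1 \<le> card I"
      by (simp add: Suc_le_eq card_gt_0_iff)
    then show "I \<subseteq> ?U \<and> 1 \<le> card I"
      using I that(1) by blast
  qed
qed

text \<open>Each application of \<open>N\<close> raises the degree by one. The sequence
  \<open>e\<close> is left abstract so as to cover both Neumann iterates and a constant sequence
  fixed by \<open>N\<close>.\<close>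

lemma order_ge_iterate:
  assumes N: "\<And>i j. i \<in> S \<Longrightarrow> j \<in> S \<Longrightarrow> order_ge U 1 (N i j)"
    and e0: "\<And>i. i \<in> S \<Longrightarrow> order_ge U 0 (e 0 i)"
    and step: "\<And>n i. i \<in> S \<Longrightarrow> e (Suc n) i = (\<Sum>j\<in>S. N i j * e n j)"
  shows "i \<in> S \<Longrightarrow> order_ge U n (e n i)"
proof (induction n arbitrary: i)
  case 0
  then show ?case
    by (rule e0)
next
  case (Suc n)
  show ?case
    unfolding step[OF Suc.prems]
    using order_ge_mult[OF N Suc.IH] Suc.prems by (intro order_ge_sum) auto
qed

text \<open>The Neumann series \<open>f + N f + N (N f) + ...\<close> is a finite sum, since
  \<open>N\<close> is nilpotent on the finitely many generators involved.\<close>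

lemma nilpotent_fixpoint_exists:
  fixes N :: "'i \<Rightarrow> 'i \<Rightarrow> zeon"
  assumes S: "finite S" and N: "\<And>i j. i \<in> S \<Longrightarrow> j \<in> S \<Longrightarrow> scalar_part (N i j) = 0"
  shows "\<exists>w. \<forall>i\<in>S. w i = f i + (\<Sum>j\<in>S. N i j * w j)"
proof -
  obtain U where U: "finite U"
    "\<And>u. u \<in> f ` S \<union> (\<lambda>(i, j). N i j) ` (S \<times> S) \<Longrightarrow> order_ge U 0 u"
    "\<And>u. u \<in> f ` S \<union> (\<lambda>(i, j). N i j) ` (S \<times> S) \<Longrightarrow> scalar_part u = 0 \<Longrightarrow> order_ge U 1 u"
    by (rule finite_common_support[of "f ` S \<union> (\<lambda>(i, j). N i j) ` (S \<times> S)"]) (use S in auto)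
  define e where "e = rec_nat f (\<lambda>_ w i. \<Sum>j\<in>S. N i j * w j)"
  have e: "e 0 = f" "e (Suc n) i = (\<Sum>j\<in>S. N i j * e n j)" for n i
    by (simp_all add: e_def)
  have ord: "order_ge U n (e n i)" if "i \<in> S" for n i
  proof (rule order_ge_iterate[where N = N and S = S and e = e, OF _ _ e(2) that])
    show "order_ge U 1 (N i j)" if "i \<in> S" "j \<in> S" for i j
      using that by (intro U(3) N) auto
    show "order_ge U 0 (e 0 i)" if "i \<in> S" for i
      using that by (simp add: e(1) U(2))
  qed
  \<comment> \<open>After \<open>Suc (card U)\<close> iterations the degree exceeds the number of
    available generators.\<close>
  define K where "K = Suc (card U)"
  have zero: "e K i = 0" if "i \<in> S" for i
    using order_ge_eq_0[OF U(1) ord[OF that]] by (simp add: K_def)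
  define w where "w = (\<lambda>i. \<Sum>n<K. e n i)"
  have "w i = f i + (\<Sum>j\<in>S. N i j * w j)" if "i \<in> S" for i
  proof -
    have "(\<Sum>j\<in>S. N i j * w j) = (\<Sum>n<K. e (Suc n) i)"
      unfolding w_def e sum_distrib_left by (rule sum.swap)
    also have "f i + \<dots> = (\<Sum>n<Suc K. e n i)"
      by (simp add: sum.lessThan_Suc_shift e(1) del: sum.lessThan_Suc)
    also have "\<dots> = w i"
      by (simp add: w_def zero that)
    finally show ?thesis ..
  qed
  then show ?thesis
    by blast
qed

text \<open>A solution of \<open>w = N w\<close> equals every iterate of itself, so its degree
  exceeds any bound.\<close>

lemma nilpotent_fixpoint_eq_0:
  fixes N :: "'i \<Rightarrow> 'i \<Rightarrow> zeon"
  assumes S: "finite S" and N: "\<And>i j. i \<in> S \<Longrightarrow> j \<in> S \<Longrightarrow> scalar_part (N i j) = 0"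
    and w: "\<And>i. i \<in> S \<Longrightarrow> w i = (\<Sum>j\<in>S. N i j * w j)" and i: "i \<in> S"
  shows "w i = 0"
proof -
  obtain U where U: "finite U"
    "\<And>u. u \<in> w ` S \<union> (\<lambda>(i, j). N i j) ` (S \<times> S) \<Longrightarrow> order_ge U 0 u"
    "\<And>u. u \<in> w ` S \<union> (\<lambda>(i, j). N i j) ` (S \<times> S) \<Longrightarrow> scalar_part u = 0 \<Longrightarrow> order_ge U 1 u"
    by (rule finite_common_support[of "w ` S \<union> (\<lambda>(i, j). N i j) ` (S \<times> S)"]) (use S in auto)
  have "order_ge U n (w i)" for n
  proof (rule order_ge_iterate[where N = N and S = S and e = "\<lambda>_. w", OF _ _ w i])
    show "order_ge U 1 (N i j)" if "i \<in> S" "j \<in> S" for i j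
      using that by (intro U(3) N) auto
    show "order_ge U 0 (w i)" if "i \<in> S" for i
      using that by (simp add: U(2))
  qed
  then show ?thesis
    using order_ge_eq_0[OF U(1), of "Suc (card U)"] by simp
qed

section \<open>Systems with diagonal invertible scalar part\<close>

lemma rescaled_system_row:
  fixes T :: "'i \<Rightarrow> 'i \<Rightarrow> zeon"
  assumes "finite S" "i \<in> S"
  shows "(\<Sum>j\<in>S. ((if i = j then 1 else 0) - s * T i j) * w j) = w i - s * (\<Sum>j\<in>S. T i j * w j)"
proof -
  have "(\<Sum>j\<in>S. ((if i = j then 1 else 0) - s * T i j) * w j)
      = (\<Sum>j\<in>S. (if i = j then w j else 0) - s * (T i j * w j))"
    by (rule sum.cong) (auto simp: algebra_simps)
  also have "\<dots> = w i - s * (\<Sum>j\<in>S. T i j * w j)"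
    using assms by (simp add: sum_subtractf sum_distrib_left)
  finally show ?thesis .
qed

text \<open>Dividing each row by the scalar part of its diagonal entry turns \<open>T\<close> into
  the identity minus a nilpotent matrix.\<close>

lemma diagonal_system_solvable:
  fixes T :: "'i \<Rightarrow> 'i \<Rightarrow> zeon"
  assumes S: "finite S"
    and T: "\<And>i j. i \<in> S \<Longrightarrow> j \<in> S \<Longrightarrow> scalar_part (T i j) = 0 \<longleftrightarrow> i \<noteq> j"
  shows "\<exists>w. \<forall>i\<in>S. (\<Sum>j\<in>S. T i j * w j) = f i"
proof -
  define t where "t i = scalar_part (T i i)" for i
  define s where "s i = zscalar (inverse (t i))" for i
  have t: "t i \<noteq> 0" if "i \<in> S" for i
    using T that by (simp add: t_def)
  define N where "N i j = (if i = j then 1 else 0) - s i * T i j" for i j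
  have N: "scalar_part (N i j) = 0" if "i \<in> S" "j \<in> S" for i j
    using T[of i j] t[of i] that by (auto simp: N_def s_def t_def)
  obtain w where w: "\<forall>i\<in>S. w i = s i * f i + (\<Sum>j\<in>S. N i j * w j)"
    using nilpotent_fixpoint_exists[where N = N and f = "\<lambda>i. s i * f i", OF S N] by blast
  have "(\<Sum>j\<in>S. T i j * w j) = f i" if i: "i \<in> S" for i
  proof -
    have "s i * (\<Sum>j\<in>S. T i j * w j) = s i * f i"
      using w[rule_format, OF i] rescaled_system_row[OF S i, of "s i" T w]
      by (simp add: N_def algebra_simps)
    then have "(zscalar (t i) * s i) * (\<Sum>j\<in>S. T i j * w j) = (zscalar (t i) * s i) * f i"
      by (simp only: mult.assoc)
    then show ?thesis
      using zscalar_inverse[OF t[OF i]] by (simp add: s_def mult.commute)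
  qed
  then show ?thesis
    by blast
qed

lemma diagonal_system_eq_0:
  fixes T :: "'i \<Rightarrow> 'i \<Rightarrow> zeon"
  assumes S: "finite S"
    and T: "\<And>i j. i \<in> S \<Longrightarrow> j \<in> S \<Longrightarrow> scalar_part (T i j) = 0 \<longleftrightarrow> i \<noteq> j"
    and w: "\<And>i. i \<in> S \<Longrightarrow> (\<Sum>j\<in>S. T i j * w j) = 0" and i: "i \<in> S"
  shows "w i = 0"
proof -
  define s where "s i = zscalar (inverse (scalar_part (T i i)))" for i
  define N where "N i j = (if i = j then 1 else 0) - s i * T i j" for i j
  have N: "scalar_part (N i j) = 0" if "i \<in> S" "j \<in> S" for i j
    using T[of i j] T[of i i] that by (cases "i = j") (simp_all add: N_def s_def)
  have fix_w: "w i = (\<Sum>j\<in>S. N i j * w j)" if "i \<in> S" for i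
    unfolding N_def rescaled_system_row[OF S that] w[OF that] by simp
  show ?thesis
    by (rule nilpotent_fixpoint_eq_0[where N = N and w = w, OF S N fix_w i])
qed

section \<open>Eigenvalues over a simple scalar eigenvalue\<close>

text \<open>The scalar part of \<open>\<xi>\<^sup>\<dagger>\<xi>\<close> is a sum of squared
  moduli.\<close>

lemma non_null_iff:
  "non_null \<xi> \<longleftrightarrow> (\<exists>i<dim_vec \<xi>. scalar_part (\<xi> $ i) \<noteq> 0)"
proof -
  have "scalar_part (conjugate \<xi> \<bullet> \<xi>)
      = of_real (\<Sum>i = 0..<dim_vec \<xi>. (cmod (scalar_part (\<xi> $ i)))\<^sup>2)"
    by (simp add: scalar_prod_def complex_norm_square mult.commute del: of_real_power)
  also have "\<dots> = 0 \<longleftrightarrow> (\<forall>i\<in>{0..<dim_vec \<xi>}. scalar_part (\<xi> $ i) = 0)"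
    by (simp only: of_real_eq_0_iff) (subst sum_nonneg_eq_0_iff, auto)
  finally show ?thesis
    unfolding non_null_def by auto
qed

lemma zeon_eigenvalue_iff:
  assumes "M \<in> carrier_mat m m"
  shows "zeon_eigenvalue M \<mu> \<longleftrightarrow>
    (\<exists>\<xi>. (\<exists>i<m. scalar_part (\<xi> i) \<noteq> 0) \<and> (\<forall>i<m. (\<Sum>j<m. M $$ (i, j) * \<xi> j) = \<mu> * \<xi> i))"
    (is "_ \<longleftrightarrow> (\<exists>\<xi>. ?P \<xi>)")
proof
  have dims: "dim_row M = m" "dim_col M = m"
    using assms by auto
  show "\<exists>\<xi>. ?P \<xi>" if "zeon_eigenvalue M \<mu>"
  proof -
    obtain \<xi> where \<xi>: "dim_vec \<xi> = m" "non_null \<xi>" "M *\<^sub>v \<xi> = \<mu> \<cdot>\<^sub>v \<xi>"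
      using \<open>zeon_eigenvalue M \<mu>\<close> dims unfolding zeon_eigenvalue_def by (metis carrier_vecD)
    have "(M *\<^sub>v \<xi>) $ i = (\<Sum>j<m. M $$ (i, j) * \<xi> $ j)" if "i < m" for i
      using that \<xi>(1) dims by (simp add: scalar_prod_def lessThan_atLeast0)
    then have "(\<Sum>j<m. M $$ (i, j) * \<xi> $ j) = \<mu> * \<xi> $ i" if "i < m" for i
      using that \<xi> by simp
    then have "?P (\<lambda>i. \<xi> $ i)"
      using \<xi>(1,2) by (auto simp: non_null_iff)
    then show ?thesis
      by blast
  qed
  assume "\<exists>\<xi>. ?P \<xi>"
  then obtain \<xi> where \<xi>: "?P \<xi>"
    by blast
  have "M *\<^sub>v vec m \<xi> = \<mu> \<cdot>\<^sub>v vec m \<xi>"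
    using \<xi> dims by (intro eq_vecI) (auto simp: scalar_prod_def lessThan_atLeast0)
  moreover have "non_null (vec m \<xi>)"
    using \<xi> by (auto simp: non_null_iff)
  ultimately show "zeon_eigenvalue M \<mu>"
    unfolding zeon_eigenvalue_def using dims by (intro bexI[of _ "vec m \<xi>"]) auto
qed

lemma sum_single_scalar:
  fixes g h :: "nat \<Rightarrow> zeon"
  assumes "i < m" "\<And>j. j < m \<Longrightarrow> j \<noteq> i \<Longrightarrow> scalar_part (g j) = 0"
  shows "scalar_part (\<Sum>j<m. g j * h j) = scalar_part (g i) * scalar_part (h i)"
proof -
  have "scalar_part (\<Sum>j<m. g j * h j)
      = (\<Sum>j<m. if j = i then scalar_part (g j) * scalar_part (h j) else 0)"
    unfolding scalar_part_sum using assms(2) by (intro sum.cong) auto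
  then show ?thesis
    using assms(1) by simp
qed

lemma eigenvalue_over_simple_scalar_unique:
  assumes M: "M \<in> carrier_mat m m" and p: "p < m"
    and off: "\<And>i j. i < m \<Longrightarrow> j < m \<Longrightarrow> i \<noteq> j \<Longrightarrow> scalar_part (M $$ (i, j)) = 0"
    and diag: "\<And>i. i < m \<Longrightarrow> i \<noteq> p \<Longrightarrow> scalar_part (M $$ (i, i)) \<noteq> scalar_part (M $$ (p, p))"
    and \<kappa>: "zeon_eigenvalue M \<kappa>" "scalar_part \<kappa> = scalar_part (M $$ (p, p))"
    and \<mu>: "zeon_eigenvalue M \<mu>" "scalar_part \<mu> = scalar_part (M $$ (p, p))"
  shows "\<mu> = \<kappa>"
proof -
  \<comment> \<open>The scalar part of an eigenvector is an eigenvector of a diagonal complex matrix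
    for a simple eigenvalue, hence concentrated at \<open>p\<close>.\<close>
  have conc: "scalar_part (\<xi> p) \<noteq> 0 \<and> (\<forall>i<m. i \<noteq> p \<longrightarrow> scalar_part (\<xi> i) = 0)"
    if nn: "\<exists>i<m. scalar_part (\<xi> i) \<noteq> 0"
      and eq: "\<forall>i<m. (\<Sum>j<m. M $$ (i, j) * \<xi> j) = \<nu> * \<xi> i"
      and \<nu>: "scalar_part \<nu> = scalar_part (M $$ (p, p))" for \<xi> \<nu>
  proof -
    have "scalar_part (\<xi> i) = 0" if i: "i < m" "i \<noteq> p" for i
    proof -
      have "scalar_part (M $$ (i, i)) * scalar_part (\<xi> i) = scalar_part \<nu> * scalar_part (\<xi> i)"
        using sum_single_scalar[of i m "\<lambda>j. M $$ (i, j)" \<xi>] off i eq by (auto simp del: scalar_part_sum)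
      then show ?thesis
        using diag[OF i] \<nu> by simp
    qed
    then show ?thesis
      using nn by metis
  qed
  obtain \<xi> where \<xi>: "\<exists>i<m. scalar_part (\<xi> i) \<noteq> 0"
    "\<forall>i<m. (\<Sum>j<m. M $$ (i, j) * \<xi> j) = \<kappa> * \<xi> i"
    using \<kappa>(1) unfolding zeon_eigenvalue_iff[OF M] by blast
  obtain \<theta> where \<theta>: "\<exists>i<m. scalar_part (\<theta> i) \<noteq> 0"
    "\<forall>i<m. (\<Sum>j<m. M $$ (i, j) * \<theta> j) = \<mu> * \<theta> i"
    using \<mu>(1) unfolding zeon_eigenvalue_iff[OF M] by blast
  note c\<xi> = conc[OF \<xi> \<kappa>(2)] and c\<theta> = conc[OF \<theta> \<mu>(2)]
  \<comment> \<open>Subtracting the two eigenvalue equations, cross-multiplied by the entries at \<open>p\<close>, gives a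
    homogeneous system in the unknowns \<open>\<mu> - \<kappa>\<close> (stored at index \<open>p\<close>, where \<open>u\<close> vanishes)
    and \<open>u\<close>, whose scalar part is diagonal and invertible.\<close>
  define u where "u j = \<xi> p * \<theta> j - \<theta> p * \<xi> j" for j
  define w where "w j = (if j = p then \<mu> - \<kappa> else u j)" for j
  define T where "T i j = (if j = p then - (\<theta> p * \<xi> i)
    else M $$ (i, j) - (if i = j then \<mu> else 0))" for i j
  have "w p = 0"
  proof (rule diagonal_system_eq_0[where S = "{..<m}" and T = T])
    show "scalar_part (T i j) = 0 \<longleftrightarrow> i \<noteq> j" if "i \<in> {..<m}" "j \<in> {..<m}" for i j
      using that c\<xi> c\<theta> off diag \<mu>(2) by (auto simp: T_def)
    show "(\<Sum>j\<in>{..<m}. T i j * w j) = 0" if "i \<in> {..<m}" for i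
    proof -
      have i: "i < m"
        using that by simp
      \<comment> \<open>As \<open>u p = 0\<close>, column \<open>p\<close> of
        \<open>M - \<mu>\<close> can be put back at no cost.\<close>
      have "T i j * w j = M $$ (i, j) * u j - (if j = i then \<mu> * u j else 0)
          - (if j = p then \<theta> p * \<xi> i * (\<mu> - \<kappa>) else 0)" for j
        by (auto simp: T_def w_def u_def algebra_simps)
      then have "(\<Sum>j<m. T i j * w j)
          = (\<Sum>j<m. M $$ (i, j) * u j) - \<mu> * u i - \<theta> p * \<xi> i * (\<mu> - \<kappa>)"
        using i p by (simp add: sum_subtractf)
      also have "(\<Sum>j<m. M $$ (i, j) * u j)
          = \<xi> p * (\<Sum>j<m. M $$ (i, j) * \<theta> j) - \<theta> p * (\<Sum>j<m. M $$ (i, j) * \<xi> j)"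
        by (simp add: u_def sum_subtractf sum_distrib_left algebra_simps)
      also have "\<dots> = \<xi> p * (\<mu> * \<theta> i) - \<theta> p * (\<kappa> * \<xi> i)"
        using \<xi>(2) \<theta>(2) i by simp
      finally show ?thesis
        by (simp add: u_def algebra_simps)
    qed
  qed (use p in auto)
  then show ?thesis
    by (simp add: w_def)
qed

section \<open>The two Laplacians\<close>

text \<open>In the application \<open>S\<close> holds the vertices other than \<open>p\<close>,
  \<open>A\<close> is the 0/1 adjacency, \<open>z\<close> gives the generators, and
  \<open>b j\<close> is the degree of \<open>j\<close> minus that of \<open>p\<close>.\<close>

locale weighted_adjacency =
  fixes S :: "nat set" and p :: nat and A :: "nat \<Rightarrow> nat \<Rightarrow> zeon" and z :: "nat \<Rightarrow> zeon"
    and b :: "nat \<Rightarrow> complex"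
  assumes fin: "finite S" and p_notin: "p \<notin> S"
    and A_sym: "A i j = A j i"
    and z_square: "z i * z i = 0" and z_scalar: "scalar_part (z i) = 0"
    and b_nz: "j \<in> S \<Longrightarrow> b j \<noteq> 0"
begin

text \<open>\<open>\<rho> j\<close> is the generating function of the walks from \<open>p\<close> to \<open>j\<close> inside \<open>S\<close>, each vertex
  \<open>k\<close> other than \<open>p\<close> contributing \<open>z k / b k\<close>; since \<open>z j * z j = 0\<close>, only paths survive.\<close>

definition path_solution :: "(nat \<Rightarrow> zeon) \<Rightarrow> bool" where
  "path_solution \<rho> \<longleftrightarrow>
    (\<forall>j\<in>S. zscalar (b j) * \<rho> j = z j * (A j p + (\<Sum>k\<in>S. A j k * \<rho> k)))"

lemma system_solvable:
  assumes N: "\<And>j k. j \<in> S \<Longrightarrow> k \<in> S \<Longrightarrow> scalar_part (N j k) = 0"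
  shows "\<exists>\<tau>. \<forall>j\<in>S. zscalar (b j) * \<tau> j = f j + (\<Sum>k\<in>S. N j k * \<tau> k)"
proof -
  define T where "T j k = (if j = k then zscalar (b j) else 0) - N j k" for j k
  have "\<exists>\<tau>. \<forall>j\<in>S. (\<Sum>k\<in>S. T j k * \<tau> k) = f j"
    by (rule diagonal_system_solvable[OF fin]) (use b_nz N in \<open>auto simp: T_def\<close>)
  then obtain \<tau> where \<tau>: "\<forall>j\<in>S. (\<Sum>k\<in>S. T j k * \<tau> k) = f j"
    by blast
  have "zscalar (b j) * \<tau> j = f j + (\<Sum>k\<in>S. N j k * \<tau> k)" if j: "j \<in> S" for j
  proof -
    have "T j k * \<tau> k = (if j = k then zscalar (b j) * \<tau> k else 0) - N j k * \<tau> k" for k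
      by (simp add: T_def algebra_simps)
    then have "(\<Sum>k\<in>S. T j k * \<tau> k) = zscalar (b j) * \<tau> j - (\<Sum>k\<in>S. N j k * \<tau> k)"
      using j fin by (simp add: sum_subtractf)
    then show ?thesis
      using \<tau> j by (simp add: diff_eq_eq)
  qed
  then show ?thesis
    by blast
qed

lemma path_solution_exists: "\<exists>\<rho>. path_solution \<rho>"
proof -
  have "\<exists>\<rho>. \<forall>j\<in>S. zscalar (b j) * \<rho> j = z j * A j p + (\<Sum>k\<in>S. z j * A j k * \<rho> k)"
    by (rule system_solvable) (simp add: z_scalar)
  then show ?thesis
    unfolding path_solution_def by (simp add: distrib_left sum_distrib_left mult.assoc)
qed

lemma path_solution_factor:
  assumes "path_solution \<rho>" "j \<in> S"
  shows "\<exists>r. \<rho> j = z j * r"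
proof -
  have "\<rho> j = zscalar (inverse (b j)) * (zscalar (b j) * \<rho> j)"
    using zscalar_inverse[OF b_nz[OF assms(2)]] by (simp add: mult.assoc[symmetric])
  also have "zscalar (b j) * \<rho> j = z j * (A j p + (\<Sum>k\<in>S. A j k * \<rho> k))"
    using assms unfolding path_solution_def by blast
  finally show ?thesis
    by (metis mult.left_commute)
qed

text \<open>Every walk counted by \<open>\<rho> j\<close> ends at \<open>j\<close> and so already
  carries the factor \<open>z j\<close>, whose square is zero.\<close>

lemma z_path_solution:
  assumes "path_solution \<rho>" "j \<in> S"
  shows "z j * \<rho> j = 0" "\<rho> j * \<rho> j = 0"
proof -
  obtain r where r: "\<rho> j = z j * r"
    using path_solution_factor[OF assms] by blast
  have "z j * \<rho> j = (z j * z j) * r" "\<rho> j * \<rho> j = (z j * z j) * (r * r)"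
    by (simp_all add: r ac_simps)
  then show "z j * \<rho> j = 0" "\<rho> j * \<rho> j = 0"
    by (simp_all add: z_square)
qed

text \<open>Walks from \<open>p\<close> closed up by a last edge back to \<open>p\<close>; the
  factor \<open>z p\<close> is left out.\<close>

definition cycle_sum :: "(nat \<Rightarrow> zeon) \<Rightarrow> zeon" where
  "cycle_sum \<rho> = (\<Sum>k\<in>S. A p k * \<rho> k)"

text \<open>Here the weight sits on the column, so \<open>\<xi> i\<close> is built from
  \<open>\<rho> i\<close> by trading its factor \<open>z i\<close> for \<open>z p\<close>; thus
  \<open>z i * \<xi> i = z p * \<rho> i\<close>.\<close>

lemma laplacian_eigenvector:
  assumes \<rho>: "path_solution \<rho>"
  obtains \<xi> where "\<xi> p = 1"
    and "\<And>i. i \<in> S \<Longrightarrow> zscalar (b i) * \<xi> i - (A i p * z p + (\<Sum>j\<in>S. A i j * z j * \<xi> j))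
        = - (z p * cycle_sum \<rho>) * \<xi> i"
    and "- (\<Sum>j\<in>S. A p j * z j * \<xi> j) = - (z p * cycle_sum \<rho>)"
proof -
  define \<xi> where "\<xi> i = (if i = p then 1
    else z p * (zscalar (inverse (b i)) * (A i p + (\<Sum>j\<in>S. A i j * \<rho> j))))" for i
  have \<xi>: "zscalar (b i) * \<xi> i = z p * (A i p + (\<Sum>j\<in>S. A i j * \<rho> j))" if "i \<in> S" for i
  proof -
    have "zscalar (b i) * \<xi> i = (zscalar (inverse (b i)) * zscalar (b i)) *
        (z p * (A i p + (\<Sum>j\<in>S. A i j * \<rho> j)))"
      using that p_notin by (auto simp: \<xi>_def ac_simps)
    then show ?thesis
      using zscalar_inverse[OF b_nz[OF that]] by simp
  qed
  have z\<xi>: "z i * \<xi> i = z p * \<rho> i" if "i \<in> S" for i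
  proof -
    have "z i * \<xi> i = z p * (zscalar (inverse (b i)) * (z i * (A i p + (\<Sum>j\<in>S. A i j * \<rho> j))))"
      using that p_notin by (auto simp: \<xi>_def ac_simps)
    also have "z i * (A i p + (\<Sum>j\<in>S. A i j * \<rho> j)) = zscalar (b i) * \<rho> i"
      using \<rho> that unfolding path_solution_def by simp
    also have "z p * (zscalar (inverse (b i)) * (zscalar (b i) * \<rho> i))
        = z p * ((zscalar (inverse (b i)) * zscalar (b i)) * \<rho> i)"
      by (simp only: mult.assoc)
    finally show ?thesis
      using zscalar_inverse[OF b_nz[OF that]] by simp
  qed
  have sums: "(\<Sum>j\<in>S. A i j * z j * \<xi> j) = z p * (\<Sum>j\<in>S. A i j * \<rho> j)" for i
    unfolding sum_distrib_left by (rule sum.cong) (simp_all add: z\<xi> mult.assoc mult.left_commute[of "z p"])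
  have row_p: "- (\<Sum>j\<in>S. A p j * z j * \<xi> j) = - (z p * cycle_sum \<rho>)"
    by (simp add: sums cycle_sum_def)
  have rows: "zscalar (b i) * \<xi> i - (A i p * z p + (\<Sum>j\<in>S. A i j * z j * \<xi> j))
        = - (z p * cycle_sum \<rho>) * \<xi> i" if "i \<in> S" for i
  proof -
    \<comment> \<open>Both sides of the row equation vanish: the left by the choice of
      \<open>\<xi>\<close>, the right because \<open>\<xi> i\<close> contains a second factor
      \<open>z p\<close>.\<close>
    have "z p * cycle_sum \<rho> * \<xi> i = (z p * z p) * (cycle_sum \<rho> *
        (zscalar (inverse (b i)) * (A i p + (\<Sum>j\<in>S. A i j * \<rho> j))))"
      using that p_notin by (auto simp: \<xi>_def ac_simps)
    moreover have "zscalar (b i) * \<xi> i - (A i p * z p + (\<Sum>j\<in>S. A i j * z j * \<xi> j)) = 0"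
      unfolding \<xi>[OF that] sums by (simp add: distrib_left mult.commute[of "A i p"])
    ultimately show ?thesis
      by (simp add: z_square)
  qed
  show ?thesis
    by (rule that[OF _ rows row_p]) (simp add: \<xi>_def)
qed

lemma sym_laplacian_eigenvector:
  assumes \<rho>: "path_solution \<rho>"
  obtains \<eta> where "\<eta> p = 1"
    and "\<And>i. i \<in> S \<Longrightarrow> zscalar (b i) * \<eta> i
        - (A i p * (z i + z p) + (\<Sum>j\<in>S. A i j * (z i + z j) * \<eta> j))
        = - (2 * (z p * cycle_sum \<rho>)) * \<eta> i"
    and "- (\<Sum>j\<in>S. A p j * (z p + z j) * \<eta> j) = - (2 * (z p * cycle_sum \<rho>))"
proof -
  define c where "c = cycle_sum \<rho>"
  have \<rho>_eq: "zscalar (b i) * \<rho> i = z i * A i p + (\<Sum>j\<in>S. A i j * z i * \<rho> j)" if "i \<in> S" for i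
    using \<rho> that by (simp add: path_solution_def distrib_left sum_distrib_left ac_simps)
  \<comment> \<open>On \<open>\<rho>\<close> the weight \<open>z i + z j\<close> acts like
    \<open>z i\<close> alone, so \<open>\<rho>\<close> solves the part of the row equations free of
    \<open>z p\<close>.\<close>
  have \<rho>_eq': "(\<Sum>j\<in>S. A i j * (z i + z j) * \<rho> j) = zscalar (b i) * \<rho> i - z i * A i p"
    if "i \<in> S" for i
  proof -
    have "A i j * (z i + z j) * \<rho> j = A i j * z i * \<rho> j + A i j * (z j * \<rho> j)" for j
      by (simp add: algebra_simps)
    then have "A i j * (z i + z j) * \<rho> j = A i j * z i * \<rho> j" if "j \<in> S" for j
      using z_path_solution(1)[OF \<rho> that] by simp
    then show ?thesis
      using \<rho>_eq[OF that] by simp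
  qed
  \<comment> \<open>This is the coefficient of \<open>z p\<close> in row \<open>i\<close> for the
    ansatz \<open>\<rho> + z p * \<tau>\<close>; the term with \<open>2 * c\<close> anticipates the
    eigenvalue.\<close>
  obtain \<tau> where \<tau>: "\<forall>i\<in>S. zscalar (b i) * \<tau> i
      = (A i p - 2 * c * \<rho> i) + (\<Sum>j\<in>S. (A i j * (z i + z j)) * \<tau> j)"
    using system_solvable[where N = "\<lambda>i j. A i j * (z i + z j)" and f = "\<lambda>i. A i p - 2 * c * \<rho> i"]
    by (auto simp: z_scalar)
  \<comment> \<open>Pairing the equations for \<open>\<tau>\<close> with \<open>\<rho>\<close>: the terms with \<open>\<rho> i * z i\<close> vanish, and what
    remains of the double sum is evaluated by the equations for \<open>\<rho>\<close>.\<close>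
  have pairing: "(\<Sum>j\<in>S. A p j * z j * \<tau> j) = c"
  proof -
    have "(\<Sum>i\<in>S. \<rho> i * (zscalar (b i) * \<tau> i))
        = (\<Sum>i\<in>S. A p i * \<rho> i + (\<Sum>j\<in>S. A j i * z j * \<rho> i * \<tau> j))"
    proof (rule sum.cong)
      fix i
      assume i: "i \<in> S"
      note nil = z_path_solution[OF \<rho> i]
      have "\<rho> i * (A i j * (z i + z j) * \<tau> j) = A i j * \<tau> j * (z i * \<rho> i) + A i j * z j * \<rho> i * \<tau> j"
        for j
        by (simp add: algebra_simps)
      then have row: "\<rho> i * (A i j * (z i + z j) * \<tau> j) = A j i * z j * \<rho> i * \<tau> j" for j
        using nil(1) by (simp add: A_sym[of j i])
      have "\<rho> i * (zscalar (b i) * \<tau> i) = \<rho> i * A i p - 2 * c * (\<rho> i * \<rho> i)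
          + (\<Sum>j\<in>S. \<rho> i * (A i j * (z i + z j) * \<tau> j))"
        unfolding \<tau>[rule_format, OF i] sum_distrib_left[symmetric]
        by (simp add: algebra_simps)
      also have "\<dots> = A p i * \<rho> i + (\<Sum>j\<in>S. A j i * z j * \<rho> i * \<tau> j)"
        unfolding row nil(2) A_sym[of i p] by (simp add: mult.commute)
      finally show "\<rho> i * (zscalar (b i) * \<tau> i) = A p i * \<rho> i + (\<Sum>j\<in>S. A j i * z j * \<rho> i * \<tau> j)" .
    qed simp
    also have "\<dots> = c + (\<Sum>j\<in>S. \<Sum>i\<in>S. A j i * z j * \<rho> i * \<tau> j)"
      by (subst sum.swap) (simp add: sum.distrib c_def cycle_sum_def)
    \<comment> \<open>The sum of \<open>\<rho> j * (zscalar (b j) * \<tau> j)\<close> reappears and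
      cancels against the left-hand side, leaving the claim.\<close>
    also have "(\<Sum>j\<in>S. \<Sum>i\<in>S. A j i * z j * \<rho> i * \<tau> j)
        = (\<Sum>j\<in>S. \<rho> j * (zscalar (b j) * \<tau> j) - A p j * z j * \<tau> j)"
    proof (rule sum.cong)
      fix j
      assume j: "j \<in> S"
      have "(\<Sum>i\<in>S. A j i * z j * \<rho> i * \<tau> j) = (zscalar (b j) * \<rho> j - z j * A j p) * \<tau> j"
        using \<rho>_eq[OF j] by (simp add: sum_distrib_right)
      then show "(\<Sum>i\<in>S. A j i * z j * \<rho> i * \<tau> j)
          = \<rho> j * (zscalar (b j) * \<tau> j) - A p j * z j * \<tau> j"
        using A_sym[of j p] by (simp add: algebra_simps)
    qed simp
    finally show ?thesis
      by (simp add: sum_subtractf)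
  qed
  define \<eta> where "\<eta> i = (if i = p then 1 else \<rho> i + z p * \<tau> i)" for i
  have \<eta>: "\<eta> i = \<rho> i + z p * \<tau> i" if "i \<in> S" for i
    using that p_notin by (auto simp: \<eta>_def)
  show ?thesis
  proof
    show "\<eta> p = 1"
      by (simp add: \<eta>_def)
    show "- (\<Sum>j\<in>S. A p j * (z p + z j) * \<eta> j) = - (2 * (z p * cycle_sum \<rho>))"
    proof -
      \<comment> \<open>Of the four products two vanish. The sums of the other two are each
        \<open>z p * c\<close>, the second by \<open>pairing\<close>.\<close>
      have "A p j * (z p + z j) * \<eta> j = z p * (A p j * \<rho> j) + z p * (A p j * z j * \<tau> j)"
        if j: "j \<in> S" for j
      proof -
        have "A p j * (z p + z j) * \<eta> j = z p * (A p j * \<rho> j) + A p j * (z j * \<rho> j)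
            + A p j * (z p * z p) * \<tau> j + z p * (A p j * z j * \<tau> j)"
          by (simp add: \<eta>[OF j] algebra_simps)
        then show ?thesis
          by (simp add: z_square z_path_solution[OF \<rho> j])
      qed
      then have "(\<Sum>j\<in>S. A p j * (z p + z j) * \<eta> j) = z p * c + z p * c"
        by (simp add: sum.distrib sum_distrib_left[symmetric] pairing)
          (simp add: c_def cycle_sum_def)
      then show ?thesis
        by (simp add: c_def)
    qed
    show "zscalar (b i) * \<eta> i - (A i p * (z i + z p) + (\<Sum>j\<in>S. A i j * (z i + z j) * \<eta> j))
        = - (2 * (z p * cycle_sum \<rho>)) * \<eta> i" if i: "i \<in> S" for i
    proof -
      have "(\<Sum>j\<in>S. A i j * (z i + z j) * \<eta> j) = (\<Sum>j\<in>S. A i j * (z i + z j) * \<rho> j)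
          + z p * (\<Sum>j\<in>S. A i j * (z i + z j) * \<tau> j)"
        unfolding sum_distrib_left sum.distrib[symmetric]
        by (rule sum.cong) (simp_all add: \<eta> algebra_simps)
      also have "\<dots> = zscalar (b i) * \<rho> i - z i * A i p
          + z p * (zscalar (b i) * \<tau> i - A i p + 2 * c * \<rho> i)"
        using \<tau>[rule_format, OF i] \<rho>_eq'[OF i] by (simp add: algebra_simps)
      finally have "zscalar (b i) * \<eta> i
          - (A i p * (z i + z p) + (\<Sum>j\<in>S. A i j * (z i + z j) * \<eta> j)) = - (2 * (z p * c) * \<rho> i)"
        by (simp add: \<eta>[OF i] algebra_simps)
      moreover have "2 * (z p * c) * \<eta> i = 2 * (z p * c) * \<rho> i + 2 * c * (z p * z p) * \<tau> i"
        by (simp add: \<eta>[OF i] algebra_simps)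
      ultimately show ?thesis
        by (simp add: z_square c_def)
    qed
  qed
qed

end

text \<open>With \<open>\<xi> p = 1\<close>, row \<open>p\<close> alone determines the dual part
  \<open>\<delta>\<close>. Moving \<open>d p\<close> to the left gives the remaining rows the form
  used in the locale.\<close>

lemma zeon_eigenvalueI_split:
  assumes M: "M \<in> carrier_mat m m" and p: "p < m"
    and entries: "\<And>i j. i < m \<Longrightarrow> j < m \<Longrightarrow>
      M $$ (i, j) = (if i = j then zscalar (d i) else 0) - B i j"
    and "B p p = 0" and \<xi>p: "\<xi> p = 1"
    and rows: "\<And>i. i \<in> {..<m} - {p} \<Longrightarrow>
      zscalar (d i - d p) * \<xi> i - (B i p + (\<Sum>j\<in>{..<m} - {p}. B i j * \<xi> j)) = \<delta> * \<xi> i"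
    and row_p: "- (\<Sum>j\<in>{..<m} - {p}. B p j * \<xi> j) = \<delta>"
  shows "zeon_eigenvalue M (zscalar (d p) + \<delta>)"
  unfolding zeon_eigenvalue_iff[OF M]
proof (intro exI conjI allI impI)
  show "p < m" "scalar_part (\<xi> p) \<noteq> 0"
    using p \<xi>p by auto
  fix i
  assume i: "i < m"
  have "M $$ (i, j) * \<xi> j = (if i = j then zscalar (d i) * \<xi> j else 0) - B i j * \<xi> j" if "j < m" for j
    using entries[OF i that] by (simp add: left_diff_distrib)
  then have "(\<Sum>j<m. M $$ (i, j) * \<xi> j) = zscalar (d i) * \<xi> i - (\<Sum>j<m. B i j * \<xi> j)"
    using i by (simp add: sum_subtractf)
  also have "(\<Sum>j<m. B i j * \<xi> j) = B i p + (\<Sum>j\<in>{..<m} - {p}. B i j * \<xi> j)"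
    using p \<xi>p by (simp add: sum.remove[of "{..<m}" p])
  also have "zscalar (d i) * \<xi> i - \<dots> = (zscalar (d p) + \<delta>) * \<xi> i"
  proof (cases "i = p")
    case True
    then show ?thesis
      using row_p \<open>B p p = 0\<close> \<xi>p by simp
  next
    case False
    then have "i \<in> {..<m} - {p}"
      using i by simp
    from rows[OF this, symmetric] show ?thesis
      by (simp add: zscalar_diff distrib_right left_diff_distrib)
  qed
  finally show "(\<Sum>j<m. M $$ (i, j) * \<xi> j) = (zscalar (d p) + \<delta>) * \<xi> i" .
qed

section \<open>Entries of the graph Laplacians\<close>

lemma conjugate_zgen: "conjugate (zgen i) = zgen i"
  by transfer auto

lemma zeon_laplacian_carrier:
  "zeon_laplacian m v E \<in> carrier_mat m m" "zeon_laplacian_sym m v E \<in> carrier_mat m m"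
  unfolding zeon_laplacian_def zeon_laplacian_sym_def degree_matrix_def
    nilpotent_adjacency_def dagger_def
  by (intro carrier_matI; simp)+

lemma zeon_laplacian_entry:
  assumes "i < m" "j < m"
  shows "zeon_laplacian m v E $$ (i, j)
    = (if i = j then zscalar (of_nat (graph_degree E (v (Suc i)))) else 0)
      - of_bool ({v (Suc i), v (Suc j)} \<in> E) * zgen (Suc j)"
  using assms by (simp add: zeon_laplacian_def degree_matrix_def nilpotent_adjacency_def zscalar_of_nat)

lemma zeon_laplacian_sym_entry:
  assumes "i < m" "j < m"
  shows "zeon_laplacian_sym m v E $$ (i, j)
    = (if i = j then zscalar (of_nat (graph_degree E (v (Suc i)))) else 0)
      - of_bool ({v (Suc i), v (Suc j)} \<in> E) * (zgen (Suc i) + zgen (Suc j))"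
  using assms
  by (auto simp: zeon_laplacian_sym_def degree_matrix_def nilpotent_adjacency_def dagger_def
      zscalar_of_nat conjugate_zgen insert_commute)

theorem theorem4p4:
  fixes V :: "'v set" and E :: "'v set set" and m :: nat and v :: "nat \<Rightarrow> 'v"
    and x :: 'v and lam lam_star :: zeon
  assumes "simple_graph V E"
    and "bij_betw v {1..m} V"
    and "unique_degree V E x"
    and "lam = associated_eigenvalue m v E x"
    and "lam_star = zscalar (scalar_part lam) + 2 * dual_part lam"
  shows "zeon_eigenvalue (zeon_laplacian_sym m v E) lam_star \<and>
         scalar_part lam_star = scalar_part lam \<and>
         (\<forall>mu. zeon_eigenvalue (zeon_laplacian_sym m v E) mu \<and>
               scalar_part mu = scalar_part lam \<longrightarrow> mu = lam_star)"
proof -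
  have "x \<in> v ` {1..m}"
    using assms(2,3) by (simp add: bij_betw_def unique_degree_def)
  then obtain k where "k \<in> {1..m}" "v k = x"
    by blast
  \<comment> \<open>Vertices are numbered from 1 and matrix rows from 0.\<close>
  then have "k - 1 < m" "v (Suc (k - 1)) = x"
    by auto
  then obtain p where p: "p < m" "v (Suc p) = x"
    by blast
  define A :: "nat \<Rightarrow> nat \<Rightarrow> zeon" where "A i j = of_bool ({v (Suc i), v (Suc j)} \<in> E)" for i j
  define z where "z i = zgen (Suc i)" for i
  define d :: "nat \<Rightarrow> complex" where "d i = of_nat (graph_degree E (v (Suc i)))" for i
  define S where "S = {..<m} - {p}"
  have "{v (Suc i), v (Suc i)} \<notin> E" for i
    using assms(1) unfolding simple_graph_def
    by (metis card_1_singleton_iff insert_absorb2 n_not_Suc_n numeral_2_eq_2 One_nat_def)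
  then have loopfree: "A i i = 0" for i
    by (simp add: A_def)
  have d_neq: "d i \<noteq> d p" if "i < m" "i \<noteq> p" for i
  proof
    assume "d i = d p"
    moreover have "v (Suc i) \<in> V"
      using assms(2) that(1) by (auto simp: bij_betw_def)
    ultimately have "v (Suc i) = v (Suc p)"
      using assms(3) p by (simp add: d_def unique_degree_def)
    then show False
      using inj_onD[OF bij_betw_imp_inj_on[OF assms(2)], of "Suc i" "Suc p"] that p(1) by simp
  qed
  interpret weighted_adjacency S p A z "\<lambda>i. d i - d p"
    by unfold_locales (auto simp: S_def A_def z_def zgen_square insert_commute dest: d_neq)
  obtain \<rho> where \<rho>: "path_solution \<rho>"
    using path_solution_exists by blast
  \<comment> \<open>The same \<open>\<rho>\<close> serves both matrices: the eigenvalues are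
    \<open>d p - \<epsilon>\<close> and \<open>d p - 2 * \<epsilon>\<close>.\<close>
  define \<epsilon> where "\<epsilon> = z p * cycle_sum \<rho>"
  let ?L = "zeon_laplacian m v E" and ?M = "zeon_laplacian_sym m v E"
  have L_entry: "?L $$ (i, j) = (if i = j then zscalar (d i) else 0) - A i j * z j"
    and M_entry: "?M $$ (i, j) = (if i = j then zscalar (d i) else 0) - A i j * (z i + z j)"
    if "i < m" "j < m" for i j
    using that by (simp_all add: zeon_laplacian_entry zeon_laplacian_sym_entry A_def z_def d_def)
  obtain \<xi> where \<xi>: "\<xi> p = 1"
    "\<And>i. i \<in> S \<Longrightarrow> zscalar (d i - d p) * \<xi> i - (A i p * z p + (\<Sum>j\<in>S. A i j * z j * \<xi> j)) = - \<epsilon> * \<xi> i"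
    "- (\<Sum>j\<in>S. A p j * z j * \<xi> j) = - \<epsilon>"
    by (fact laplacian_eigenvector[OF \<rho>, folded \<epsilon>_def])
  have L: "zeon_eigenvalue ?L (zscalar (d p) + - \<epsilon>)"
    by (rule zeon_eigenvalueI_split[OF zeon_laplacian_carrier(1) p(1) L_entry _ \<xi>[unfolded S_def]])
      (simp_all add: loopfree)
  obtain \<eta> where \<eta>: "\<eta> p = 1"
    "\<And>i. i \<in> S \<Longrightarrow> zscalar (d i - d p) * \<eta> i
        - (A i p * (z i + z p) + (\<Sum>j\<in>S. A i j * (z i + z j) * \<eta> j)) = - (2 * \<epsilon>) * \<eta> i"
    "- (\<Sum>j\<in>S. A p j * (z p + z j) * \<eta> j) = - (2 * \<epsilon>)"
    by (fact sym_laplacian_eigenvector[OF \<rho>, folded \<epsilon>_def])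
  have M: "zeon_eigenvalue ?M (zscalar (d p) + - (2 * \<epsilon>))"
    by (rule zeon_eigenvalueI_split[OF zeon_laplacian_carrier(2) p(1) M_entry _ \<eta>[unfolded S_def]])
      (simp_all add: loopfree)
  have \<epsilon>0: "scalar_part \<epsilon> = 0"
    by (simp add: \<epsilon>_def z_scalar)
  have L_unique: "\<mu> = zscalar (d p) + - \<epsilon>"
    if "zeon_eigenvalue ?L \<mu>" "scalar_part \<mu> = d p" for \<mu>
    by (rule eigenvalue_over_simple_scalar_unique[OF zeon_laplacian_carrier(1) p(1) _ _ L _ that(1)])
      (use that(2) p(1) d_neq in \<open>simp_all add: L_entry z_scalar \<epsilon>0\<close>)
  have M_unique: "\<mu> = zscalar (d p) + - (2 * \<epsilon>)"
    if "zeon_eigenvalue ?M \<mu>" "scalar_part \<mu> = d p" for \<mu>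
    by (rule eigenvalue_over_simple_scalar_unique[OF zeon_laplacian_carrier(2) p(1) _ _ M _ that(1)])
      (use that(2) p(1) d_neq in \<open>simp_all add: M_entry z_scalar \<epsilon>0\<close>)
  have dx: "of_nat (graph_degree E x) = d p"
    by (simp add: d_def p(2))
  \<comment> \<open>The definite description is resolved by existence \<open>L\<close> together with
    \<open>L_unique\<close>.\<close>
  have lam: "lam = zscalar (d p) + - \<epsilon>"
    unfolding assms(4) associated_eigenvalue_def dx
  proof (rule the_equality)
    show "zeon_eigenvalue ?L (zscalar (d p) + - \<epsilon>) \<and> scalar_part (zscalar (d p) + - \<epsilon>) = d p"
      using L by (simp add: \<epsilon>0)
  qed (use L_unique in blast)
  have scalar_lam: "scalar_part lam = d p"
    unfolding lam by (simp add: \<epsilon>0)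
  have "dual_part lam = - \<epsilon>"
    unfolding dual_part_def scalar_lam unfolding lam by simp
  then have lam_star: "lam_star = zscalar (d p) + - (2 * \<epsilon>)"
    unfolding assms(5) scalar_lam by simp
  have "scalar_part lam_star = d p"
    unfolding lam_star by (simp add: \<epsilon>0)
  then show ?thesis
    using M M_unique unfolding lam_star scalar_lam by blast
qed

end
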